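(* Let $\mathcal G=(\mathcal V,\mathcal E)$ be a weakly connected directed multigraph with link weight bounds $w^l,w^u\in\mathbb R^{\mathcal E}_{>0}$ ($w^l\le w^u$), link capacity bounds $c^l\in\mathbb R^{\mathcal E}_{<0}$, $c^u\in\mathbb R^{\mathcal E}_{>0}$, and initial supply-demand vector $p_0\in\mathbb R^{\mathcal V}$, $\mathbf 1^{\mathrm T}p_0=0$. Assume the initial flow $f(w_0,p_0)$, for the given initial weight $w_0\in[w^l,w^u]$, satisfies $c^l\le f(w_0,p_0)\le c^u$. Suppose $\mathcal G$ is reducible about $v_1,v_2\in\mathcal V$ under $p_0$, with partition $\mathcal G=\mathcal G_1\cup\mathcal G_2$, $\mathcal G_k=(\mathcal V_k,\mathcal E_k)$, and reduction $\tilde{\mathcal G}_1=(\mathcal V_1,\mathcal E_1\cup\{(v_1,v_2)\})$. Then, under nongenerative disturbances, the weight control value $$\min_{\delta}\ \max\{\mu\ge 0:\ \exists\, w\in[w^l,w^u],\ c^l\le f^{\mathcal G}(w,p_0+\mu\delta)\le c^u\}$$ is equal to $$\min_{\delta}\ \max_{\mu,\,w_{\mathcal E_1},\,w_{\mathrm{eq}}}\ \mu$$ where the inner maximum is over $\mu\ge 0$, $w_{\mathcal E_1}\in[w^l_{\mathcal E_1},w^u_{\mathcal E_1}]$, $w_{\mathrm{eq}}\in[\mathcal H(w^l_{\mathcal E_2}),\mathcal H(w^u_{\mathcal E_2})]$ subject to $$c^l_i\le f_i^{\tilde{\mathcal G}_1}\big((w_{\mathcal E_1},w_{\mathrm{eq}}),(p_0+\mu\delta)_{\mathcal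 V_1}\big)\le c_i^u\quad\forall i\in\mathcal E_1,$$ $$g^l(w_{\mathrm{eq}})\le f_{v_1v_2}^{\tilde{\mathcal G}_1}\big((w_{\mathcal E_1},w_{\mathrm{eq}}),(p_0+\mu\delta)_{\mathcal V_1}\big)\le g^u(w_{\mathrm{eq}}).$$ In both problems the outer minimum is over $\delta\in\mathbb R^{\mathcal V}$ that are nongenerative with respect to $p_0$ with $\|\delta\|_1=1$. Here $g^l(w_{\mathrm{eq}})=\min G(w_{\mathrm{eq}})$, $g^u(w_{\mathrm{eq}})=\max G(w_{\mathrm{eq}})$ with $$G(w_{\mathrm{eq}}):=\{z\in\mathbb R:\ c^l_{\mathcal E_2}\le z f^{\mathcal G_2}(w_{\mathcal E_2},a_{v_1v_2})\le c^u_{\mathcal E_2}\text{ for some }w_{\mathcal E_2}\in[w^l_{\mathcal E_2},w^u_{\mathcal E_2}]\text{ with }\mathcal H(w_{\mathcal E_2})=w_{\mathrm{eq}}\}.$$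
   Context: Multigraphs are finite, with parallel links allowed and no self-loops; link $i$ goes from tail $\sigma(i)$ to head $\tau(i)$. For a weakly connected multigraph $\mathcal G$, the incidence matrix $A$ has $A_{vi}=1$ if $v=\sigma(i)$, $-1$ if $v=\tau(i)$, $0$ otherwise; for weights $w>\mathbf 0$, $W=\mathrm{diag}(w)$, $L_{\mathcal G}=AWA^{\mathrm T}$, $L_{\mathcal G}^\dagger$ is the Moore–Penrose pseudoinverse, and for balanced $p$ ($\mathbf 1^{\mathrm T}p=0$) the DC flow is $f^{\mathcal G}(w,p)=WA^{\mathrm T}L_{\mathcal G}^\dagger p$. A subscript set ($w_{\mathcal E_1}$, $p_{\mathcal V_1}$, ...) denotes the corresponding subvector. Reducible network: $\mathcal G$ is reducible about $v_1,v_2$ under $p$ if there is a partition $\mathcal G=\mathcal G_1\cup\mathcal G_2$, $\mathcal G_k=(\mathcal V_k,\mathcal E_k)$, both weakly connected, with $\mathcal V_1\cup\mathcal V_2=\mathcal V$, $\mathcal V_1\cap\mathcal V_2=\{v_1,v_2\}$, $\mathcal E_1\cup\mathcal E_2=\mathcal E$, $\mathcal E_1\cap\mathcal E_2=\emptyset$, $|\mathcal E_2|\ge 2$, and $p$ supported only on $\mathcal V_1$. The reduction $\tilde{\mathcal G}_1$ is $\mathcal G_1$ with an additional (virtual) link $(v_1,v_2)$; $f^{\tilde{\mathcal G}_1}_{v_1v_2}$ denotes the flow on this virtual link, whose weight is $w_{\mathrm{eq}}$. Nongenerative disturbance: $\delta\in\mathbb R^{\mathcal V}$ with $\mathbf 1^{\mathrm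 T}\delta=0$ is nongenerative with respect to $p_0$ if $p_{0,v}=0$ implies $\delta_v=0$ for all $v\in\mathcal V$. $a_{v_1v_2}\in\{-1,0,1\}^{\mathcal V_2}$ has entry $+1$ at $v_1$, $-1$ at $v_2$, $0$ elsewhere. The equivalent weight of $\mathcal G_2$ between $v_1$ and $v_2$ is $\mathcal H(w_{\mathcal E_2})=1/(a_{v_1v_2}^{\mathrm T}L_{\mathcal G_2}^\dagger a_{v_1v_2})$. *)

theory Defs
  imports "HOL-Analysis.Analysis" "Graph_Theory.Digraph_Component"
begin

text \<open>
  A directed multigraph is a \<open>pre_digraph\<close> of \<open>Graph_Theory\<close> with finitely many vertices and
  arcs and without loops; its vertex and arc sets are arbitrary subsets of finite types \<open>'v\<close>
  and \<open>'e\<close>, so that subgraphs live on the same types.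

  For \<open>S \<subseteq> 'i\<close>, the space $\mathbb{R}^S$ is represented by the vectors over \<open>'i\<close> that vanish
  off \<open>S\<close>, and a matrix with rows indexed by \<open>S\<close> and columns by \<open>T\<close> by its extension by zero.
  Products, transposes and Moore--Penrose inverses commute with extension by zero. The order
  on \<open>real ^ 'i\<close> is componentwise, so for \<open>l\<close>, \<open>u\<close> vanishing off \<open>S\<close> the interval \<open>{l..u}\<close>
  is the box $[l,u] \subseteq \mathbb{R}^S$.
\<close>

definition coord_space :: "'i set \<Rightarrow> (real ^ 'i::finite) set" where
  "coord_space S = {x. \<forall>i. i \<notin> S \<longrightarrow> x $ i = 0}"

definition subvec :: "'i set \<Rightarrow> real ^ 'i \<Rightarrow> real ^ 'i::finite" where
  "subvec S x = (\<chi> i. if i \<in> S then x $ i else 0)"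

definition diag_mat :: "real ^ 'i \<Rightarrow> real ^ 'i ^ 'i::finite" where
  "diag_mat w = (\<chi> i j. if i = j then w $ i else 0)"

definition is_pseudoinverse :: "real ^ 'n ^ 'm \<Rightarrow> real ^ 'm ^ 'n \<Rightarrow> bool" where
  "is_pseudoinverse M X \<longleftrightarrow>
     M ** X ** M = M \<and> X ** M ** X = X \<and>
     transpose (M ** X) = M ** X \<and> transpose (X ** M) = X ** M"

definition pseudoinverse :: "real ^ 'n ^ 'm \<Rightarrow> real ^ 'm ^ 'n" where
  "pseudoinverse M = (THE X. is_pseudoinverse M X)"

definition multigraph :: "('v, 'e) pre_digraph \<Rightarrow> bool" where
  "multigraph G \<longleftrightarrow> fin_digraph G \<and> loopfree_digraph G"

text \<open>
  The connectivity of \<open>Digraph_Component\<close> is that of the symmetric closure, i.e. weak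
  connectivity; the plain name \<open>connected\<close> is ambiguous with the topological notion.
\<close>

abbreviation weakly_connected :: "('v, 'e) pre_digraph \<Rightarrow> bool" where
  "weakly_connected G \<equiv> Digraph_Component.connected G"

definition incidence :: "('v, 'e) pre_digraph \<Rightarrow> real ^ 'e::finite ^ 'v::finite" where
  "incidence G = (\<chi> v e. if e \<in> arcs G then
       (if v = tail G e then 1 else if v = head G e then - 1 else 0) else 0)"

definition laplacian :: "('v, 'e) pre_digraph \<Rightarrow> real ^ 'e::finite \<Rightarrow> real ^ 'v ^ 'v::finite" where
  "laplacian G w = incidence G ** diag_mat w ** transpose (incidence G)"

definition dc_flow ::
    "('v, 'e) pre_digraph \<Rightarrow> real ^ 'e \<Rightarrow> real ^ 'v::finite \<Rightarrow> real ^ 'e::finite" where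
  "dc_flow G w p =
     (diag_mat w ** transpose (incidence G) ** pseudoinverse (laplacian G w)) *v p"

definition balanced :: "real ^ 'v::finite \<Rightarrow> bool" where
  "balanced p \<longleftrightarrow> (\<Sum>v\<in>UNIV. p $ v) = 0"

text \<open>
  \<open>reducible_via G v1 v2 p G1 G2\<close>: the network is reducible about \<open>v1\<close>, \<open>v2\<close> under \<open>p\<close>,
  with the partition of \<open>G\<close> into \<open>G1\<close> and \<open>G2\<close>. The vertices \<open>v1\<close> and \<open>v2\<close> are distinct,
  since the virtual link between them must not be a self-loop.
\<close>

definition reducible_via ::
    "('v, 'e) pre_digraph \<Rightarrow> 'v \<Rightarrow> 'v \<Rightarrow> real ^ 'v::finite \<Rightarrow>
     ('v, 'e) pre_digraph \<Rightarrow> ('v, 'e) pre_digraph \<Rightarrow> bool" where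
  "reducible_via G v1 v2 p G1 G2 \<longleftrightarrow>
     v1 \<noteq> v2 \<and> subgraph G1 G \<and> subgraph G2 G \<and>
     weakly_connected G1 \<and> weakly_connected G2 \<and>
     verts G1 \<union> verts G2 = verts G \<and> verts G1 \<inter> verts G2 = {v1, v2} \<and>
     arcs G1 \<union> arcs G2 = arcs G \<and> arcs G1 \<inter> arcs G2 = {} \<and>
     card (arcs G2) \<ge> 2 \<and> p \<in> coord_space (verts G1)"

text \<open>The virtual link is the arc \<open>None\<close>; the original arcs \<open>e\<close> become \<open>Some e\<close>.\<close>

definition add_virtual_link ::
    "('v, 'e) pre_digraph \<Rightarrow> 'v \<Rightarrow> 'v \<Rightarrow> ('v, 'e option) pre_digraph" where
  "add_virtual_link G1 v1 v2 =
     \<lparr> verts = verts G1, arcs = insert None (Some ` arcs G1),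
       tail = case_option v1 (tail G1), head = case_option v2 (head G1) \<rparr>"

definition add_virtual_weight :: "real ^ 'e \<Rightarrow> real \<Rightarrow> real ^ ('e::finite option)" where
  "add_virtual_weight w weq = (\<chi> i. case i of None \<Rightarrow> weq | Some e \<Rightarrow> w $ e)"

definition unit_transfer :: "'v \<Rightarrow> 'v \<Rightarrow> real ^ 'v::finite" where
  "unit_transfer v1 v2 = (\<chi> v. if v = v1 then 1 else if v = v2 then - 1 else 0)"

definition equiv_weight ::
    "('v::finite, 'e::finite) pre_digraph \<Rightarrow> 'v \<Rightarrow> 'v \<Rightarrow> real ^ 'e \<Rightarrow> real" where
  "equiv_weight G2 v1 v2 w =
     1 / (unit_transfer v1 v2 \<bullet> (pseudoinverse (laplacian G2 w) *v unit_transfer v1 v2))"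

definition nongenerative ::
    "('v, 'e) pre_digraph \<Rightarrow> real ^ 'v \<Rightarrow> real ^ 'v::finite \<Rightarrow> bool" where
  "nongenerative G p0 \<delta> \<longleftrightarrow>
     \<delta> \<in> coord_space (verts G) \<and> balanced \<delta> \<and> (\<forall>v\<in>verts G. p0 $ v = 0 \<longrightarrow> \<delta> $ v = 0)"

definition unit_disturbances ::
    "('v, 'e) pre_digraph \<Rightarrow> real ^ 'v \<Rightarrow> (real ^ 'v::finite) set" where
  "unit_disturbances G p0 = {\<delta>. nongenerative G p0 \<delta> \<and> (\<Sum>v\<in>UNIV. \<bar>\<delta> $ v\<bar>) = 1}"

definition feasible_magnitudes ::
    "('v::finite, 'e::finite) pre_digraph \<Rightarrow> real ^ 'e \<Rightarrow> real ^ 'e \<Rightarrow> real ^ 'e \<Rightarrow> real ^ 'e \<Rightarrow>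
     real ^ 'v \<Rightarrow> real ^ 'v \<Rightarrow> real set" where
  "feasible_magnitudes G wl wu cl cu p0 \<delta> =
     {\<mu>. 0 \<le> \<mu> \<and> (\<exists>w\<in>{wl..wu}.
        cl \<le> dc_flow G w (p0 + \<mu> *\<^sub>R \<delta>) \<and> dc_flow G w (p0 + \<mu> *\<^sub>R \<delta>) \<le> cu)}"

definition transfer_set ::
    "('v::finite, 'e::finite) pre_digraph \<Rightarrow> 'v \<Rightarrow> 'v \<Rightarrow>
     real ^ 'e \<Rightarrow> real ^ 'e \<Rightarrow> real ^ 'e \<Rightarrow> real ^ 'e \<Rightarrow> real \<Rightarrow> real set" where
  "transfer_set G2 v1 v2 wl wu cl cu weq =
     {z. \<exists>w2\<in>{subvec (arcs G2) wl..subvec (arcs G2) wu}.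
        equiv_weight G2 v1 v2 w2 = weq \<and>
        subvec (arcs G2) cl \<le> z *\<^sub>R dc_flow G2 w2 (unit_transfer v1 v2) \<and>
        z *\<^sub>R dc_flow G2 w2 (unit_transfer v1 v2) \<le> subvec (arcs G2) cu}"

definition g_lower ::
    "('v::finite, 'e::finite) pre_digraph \<Rightarrow> 'v \<Rightarrow> 'v \<Rightarrow>
     real ^ 'e \<Rightarrow> real ^ 'e \<Rightarrow> real ^ 'e \<Rightarrow> real ^ 'e \<Rightarrow> real \<Rightarrow> real" where
  "g_lower G2 v1 v2 wl wu cl cu weq = (LEAST z. z \<in> transfer_set G2 v1 v2 wl wu cl cu weq)"

definition g_upper ::
    "('v::finite, 'e::finite) pre_digraph \<Rightarrow> 'v \<Rightarrow> 'v \<Rightarrow>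
     real ^ 'e \<Rightarrow> real ^ 'e \<Rightarrow> real ^ 'e \<Rightarrow> real ^ 'e \<Rightarrow> real \<Rightarrow> real" where
  "g_upper G2 v1 v2 wl wu cl cu weq = (GREATEST z. z \<in> transfer_set G2 v1 v2 wl wu cl cu weq)"

definition equiv_weight_range ::
    "('v::finite, 'e::finite) pre_digraph \<Rightarrow> 'v \<Rightarrow> 'v \<Rightarrow> real ^ 'e \<Rightarrow> real ^ 'e \<Rightarrow> real set" where
  "equiv_weight_range G2 v1 v2 wl wu =
     {equiv_weight G2 v1 v2 (subvec (arcs G2) wl)..equiv_weight G2 v1 v2 (subvec (arcs G2) wu)}"

definition reduced_feasible_magnitudes ::
    "('v::finite, 'e::finite) pre_digraph \<Rightarrow> ('v, 'e) pre_digraph \<Rightarrow> 'v \<Rightarrow> 'v \<Rightarrow>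
     real ^ 'e \<Rightarrow> real ^ 'e \<Rightarrow> real ^ 'e \<Rightarrow> real ^ 'e \<Rightarrow> real ^ 'v \<Rightarrow> real ^ 'v \<Rightarrow> real set" where
  "reduced_feasible_magnitudes G1 G2 v1 v2 wl wu cl cu p0 \<delta> =
     {\<mu>. 0 \<le> \<mu> \<and>
        (\<exists>w1\<in>{subvec (arcs G1) wl..subvec (arcs G1) wu}.
         \<exists>weq\<in>equiv_weight_range G2 v1 v2 wl wu.
         let f = dc_flow (add_virtual_link G1 v1 v2) (add_virtual_weight w1 weq)
                   (subvec (verts G1) (p0 + \<mu> *\<^sub>R \<delta>))
         in (\<forall>i\<in>arcs G1. cl $ i \<le> f $ Some i \<and> f $ Some i \<le> cu $ i) \<and>
            g_lower G2 v1 v2 wl wu cl cu weq \<le> f $ None \<and>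
            f $ None \<le> g_upper G2 v1 v2 wl wu cl cu weq)}"

definition is_min_of :: "real set \<Rightarrow> real \<Rightarrow> bool" where
  "is_min_of S m \<longleftrightarrow> m \<in> S \<and> (\<forall>x\<in>S. m \<le> x)"

definition is_max_of :: "real set \<Rightarrow> real \<Rightarrow> bool" where
  "is_max_of S m \<longleftrightarrow> m \<in> S \<and> (\<forall>x\<in>S. x \<le> m)"

definition max_magnitude ::
    "('v::finite, 'e::finite) pre_digraph \<Rightarrow> real ^ 'e \<Rightarrow> real ^ 'e \<Rightarrow> real ^ 'e \<Rightarrow> real ^ 'e \<Rightarrow>
     real ^ 'v \<Rightarrow> real ^ 'v \<Rightarrow> real" where
  "max_magnitude G wl wu cl cu p0 \<delta> =
     (GREATEST \<mu>. \<mu> \<in> feasible_magnitudes G wl wu cl cu p0 \<delta>)"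

definition reduced_max_magnitude ::
    "('v::finite, 'e::finite) pre_digraph \<Rightarrow> ('v, 'e) pre_digraph \<Rightarrow> 'v \<Rightarrow> 'v \<Rightarrow>
     real ^ 'e \<Rightarrow> real ^ 'e \<Rightarrow> real ^ 'e \<Rightarrow> real ^ 'e \<Rightarrow> real ^ 'v \<Rightarrow> real ^ 'v \<Rightarrow> real" where
  "reduced_max_magnitude G1 G2 v1 v2 wl wu cl cu p0 \<delta> =
     (GREATEST \<mu>. \<mu> \<in> reduced_feasible_magnitudes G1 G2 v1 v2 wl wu cl cu p0 \<delta>)"

text \<open>
  The outer minima are taken as infima in the extended reals: the inner maximum need not be
  lower semicontinuous in \<open>\<delta>\<close>, and there is no \<open>\<delta>\<close> at all when \<open>p0 = 0\<close>, in which case the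
  value is \<open>\<infinity>\<close>.
\<close>

definition weight_control_value ::
    "('v::finite, 'e::finite) pre_digraph \<Rightarrow> real ^ 'e \<Rightarrow> real ^ 'e \<Rightarrow> real ^ 'e \<Rightarrow> real ^ 'e \<Rightarrow>
     real ^ 'v \<Rightarrow> ereal" where
  "weight_control_value G wl wu cl cu p0 =
     (INF \<delta>\<in>unit_disturbances G p0. ereal (max_magnitude G wl wu cl cu p0 \<delta>))"

definition reduced_weight_control_value ::
    "('v::finite, 'e::finite) pre_digraph \<Rightarrow> ('v, 'e) pre_digraph \<Rightarrow> ('v, 'e) pre_digraph \<Rightarrow>
     'v \<Rightarrow> 'v \<Rightarrow> real ^ 'e \<Rightarrow> real ^ 'e \<Rightarrow> real ^ 'e \<Rightarrow> real ^ 'e \<Rightarrow> real ^ 'v \<Rightarrow> ereal" where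
  "reduced_weight_control_value G G1 G2 v1 v2 wl wu cl cu p0 =
     (INF \<delta>\<in>unit_disturbances G p0.
        ereal (reduced_max_magnitude G1 G2 v1 v2 wl wu cl cu p0 \<delta>))"

end

theory Submission
  imports Defs
begin

text \<open>
  The two weight control problems agree because, for every disturbance, the feasible
  magnitudes themselves agree (\<open>feasible_magnitudes_reduction\<close>).

  A DC flow is the unique flow that comes from a potential and has the prescribed divergence
  (\<open>dc_flow_eqI\<close>). Supply and demand sit in the first part, also after a nongenerative
  disturbance, so the second part only transports some amount \<open>z\<close> from \<open>v1\<close> to \<open>v2\<close>, and by
  linearity its flow is \<open>z\<close> times its unit transfer flow. The potential difference of the
  terminals is then \<open>z\<close> divided by the equivalent weight, exactly as on a single link of that
  weight. Hence potentials of the reduction extend to potentials of the whole network, and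
  \<open>z\<close> is the flow on the virtual link (\<open>dc_flow_reduction\<close>).

  It remains to see which pairs of an equivalent weight and an amount \<open>z\<close> the second part can
  realise. By Rayleigh monotonicity (\<open>equiv_weight_mono\<close>), continuity of the equivalent weight
  and connectedness of the weight box, the attainable equivalent weights form the interval
  between the two extreme ones (\<open>equiv_weight_box\<close>). For each of them the attainable \<open>z\<close>
  form a compact set that is star-shaped about zero, because the capacity bounds enclose zero.
  Such a set is a compact interval, so it is described without loss by its two end points
  (\<open>transfers_interval\<close>).

  The maxima exist by compactness. Continuity of the flow in the weights, on which
  this rests, is obtained by writing the pseudoinverse of the Laplacian as an ordinary inverse
  minus a fixed projection, which is possible because all positive weights give the Laplacian
  the same kernel.
\<close>

section \<open>Moore--Penrose inverses\<close>

lemma is_pseudoinverse_unique: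
  fixes M :: "real ^ 'n ^ 'm"
  assumes X: "is_pseudoinverse M X" and Y: "is_pseudoinverse M Y"
  shows "X = Y"
proof -
  note x = X[unfolded is_pseudoinverse_def] and y = Y[unfolded is_pseudoinverse_def]
  have "transpose (M ** X) = transpose ((M ** Y) ** (M ** X))"
    using y by (simp add: matrix_mul_assoc)
  also have "\<dots> = (M ** X) ** (M ** Y)"
    using x y by (simp add: matrix_transpose_mul)
  also have "\<dots> = M ** Y"
    using x by (simp add: matrix_mul_assoc)
  finally have 1: "M ** X = M ** Y" using x by simp
  have "transpose (X ** M) = transpose ((X ** M) ** (Y ** M))"
    using y by (simp flip: matrix_mul_assoc)
  also have "\<dots> = (Y ** M) ** (X ** M)"
    using x y by (simp add: matrix_transpose_mul)
  also have "\<dots> = Y ** M"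
    using x by (simp flip: matrix_mul_assoc)
  finally have 2: "X ** M = Y ** M" using x by simp
  have "X = X ** (M ** X)" using x by (simp add: matrix_mul_assoc)
  also have "\<dots> = Y ** (M ** Y)" by (simp add: 1) (simp add: 2 matrix_mul_assoc)
  also have "\<dots> = Y" using y by (simp add: matrix_mul_assoc)
  finally show ?thesis .
qed

lemma pseudoinverse_eqI:
  "is_pseudoinverse M X \<Longrightarrow> pseudoinverse M = X"
  unfolding pseudoinverse_def by (blast intro: is_pseudoinverse_unique)

lemma transpose_zero: "transpose (0 :: real ^ 'n ^ 'm) = 0"
  by (simp add: transpose_def vec_eq_iff)

lemma matrix_inv_inverse:
  fixes M :: "real ^ 'n ^ 'm"
  assumes "invertible M"
  shows matrix_inv_right: "M ** matrix_inv M = mat 1"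
    and matrix_inv_left: "matrix_inv M ** M = mat 1"
  using someI_ex[OF assms[unfolded invertible_def]] by (simp_all add: matrix_inv_def)

text \<open>
  A singular symmetric matrix becomes invertible when the projection onto its kernel is added
  to it, and removing that projection again from the inverse leaves the pseudoinverse. The
  point of this detour is that the ordinary inverse depends continuously on the matrix,
  while the pseudoinverse in general does not.
\<close>

lemma pseudoinverse_via_kernel_projection:
  fixes L P :: "real ^ 'n ^ 'n"
  assumes L: "transpose L = L" and P: "transpose P = P" "P ** P = P" and LP: "L ** P = 0"
    and inv: "invertible (L + P)"
  shows "pseudoinverse L = matrix_inv (L + P) - P"
    and "L ** pseudoinverse L = mat 1 - P"
proof -
  define N where "N = matrix_inv (L + P)"
  have MN: "(L + P) ** N = mat 1" and NM: "N ** (L + P) = mat 1"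
    by (simp_all add: N_def matrix_inv_right matrix_inv_left inv)
  have PL: "P ** L = 0"
    using arg_cong[OF LP, of transpose] L P by (simp add: matrix_transpose_mul transpose_zero)
  have sub_l: "A ** (B - C) = A ** B - A ** C" and sub_r: "(A - B) ** C = A ** C - B ** C"
    and add_r: "(A + B) ** C = A ** C + B ** C"
    for A B C :: "real ^ 'n ^ 'n"
    by (simp_all add: matrix_matrix_mult_def vec_eq_iff sum_subtractf sum.distrib algebra_simps)
  have PM: "P ** (L + P) = P" and MP: "(L + P) ** P = P"
    using PL LP P by (simp_all add: matrix_add_ldistrib add_r)
  have PN: "P ** N = P" by (metis MN PM matrix_mul_assoc matrix_mul_rid)
  have NP: "N ** P = P" by (metis NM MP matrix_mul_assoc matrix_mul_lid)
  have L_eq: "L = (L + P) - P" by simp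
  have LN: "L ** N = mat 1 - P"
    by (subst L_eq, simp only: sub_r MN PN)
  have NL: "N ** L = mat 1 - P"
    by (subst L_eq, simp only: sub_l NM NP)
  have LX: "L ** (N - P) = mat 1 - P" by (simp add: sub_l LN LP)
  have XL: "(N - P) ** L = mat 1 - P" by (simp add: sub_r NL PL)
  have tr: "transpose (mat 1 - P) = mat 1 - P"
    using P(1) by (auto simp: transpose_def vec_eq_iff mat_def)
  have "is_pseudoinverse L (N - P)"
    unfolding is_pseudoinverse_def LX XL
    by (simp add: tr sub_l sub_r P PL PN NP)
  then have eq: "pseudoinverse L = N - P" by (rule pseudoinverse_eqI)
  then show "pseudoinverse L = matrix_inv (L + P) - P" by (simp add: N_def)
  show "L ** pseudoinverse L = mat 1 - P" unfolding eq by (rule LX)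
qed

text \<open>Cramer's rule writes the solution of a regular linear system as a quotient of
  polynomials in its coefficients.\<close>

lemma continuous_on_matrix_inv_vector:
  fixes M :: "'a::topological_space \<Rightarrow> real ^ 'n ^ 'n"
  assumes cont: "\<And>i j. continuous_on S (\<lambda>x. M x $ i $ j)"
    and inv: "\<And>x. x \<in> S \<Longrightarrow> invertible (M x)"
  shows "continuous_on S (\<lambda>x. matrix_inv (M x) *v b)"
proof -
  have det: "det (M x) \<noteq> 0" if "x \<in> S" for x
    using inv[OF that] by (simp add: invertible_det_nz)
  have sol: "matrix_inv (M x) *v b =
      (\<chi> k. det (\<chi> i j. if j = k then b $ i else M x $ i $ j) / det (M x))" if "x \<in> S" for x
  proof -
    have "M x *v (matrix_inv (M x) *v b) = b"
      by (simp add: matrix_vector_mul_assoc matrix_inv_right[OF inv[OF that]])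
    then show ?thesis using cramer[OF det[OF that]] by blast
  qed
  have entry: "continuous_on S (\<lambda>x. if j = k then b $ i else M x $ i $ j)" for i j k
    by (cases "j = k") (simp_all add: cont)
  have "continuous_on S (\<lambda>x. det (A x))"
    if "\<And>i j. continuous_on S (\<lambda>x. A x $ i $ j)" for A :: "'a \<Rightarrow> real ^ 'n ^ 'n"
    unfolding det_def
    by (intro continuous_on_sum continuous_on_mult continuous_on_const continuous_on_prod that)
  then have "continuous_on S
      (\<lambda>x. \<chi> k. det (\<chi> i j. if j = k then b $ i else M x $ i $ j) / det (M x))"
    by (intro continuous_on_vec_lambda continuous_on_divide) (simp_all add: cont entry det)
  then show ?thesis by (rule continuous_on_eq) (simp add: sol)
qed


section \<open>Potential flows on a connected network\<close>

text \<open>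
  Weak connectivity enters only through potentials: one that takes equal values at the ends of
  every arc is constant. This form passes to the network with the virtual link at once, since
  that network has more arcs on the same vertices.
\<close>

locale flow_network = loopfree_digraph N
  for N :: "('v::finite, 'e::finite) pre_digraph" +
  assumes verts_nonempty: "verts N \<noteq> {}"
    and potential_constant:
      "\<lbrakk>\<And>e. e \<in> arcs N \<Longrightarrow> \<phi> (tail N e) = (\<phi> (head N e) :: real); u \<in> verts N; v \<in> verts N\<rbrakk>
        \<Longrightarrow> \<phi> u = \<phi> v"

lemma weakly_connected_flow_network:
  fixes N :: "('v::finite, 'e::finite) pre_digraph"
  assumes "loopfree_digraph N" "weakly_connected N"
  shows "flow_network N"
proof -
  interpret loopfree_digraph N by fact
  have conn: "verts N \<noteq> {}"
    "\<And>u v. \<lbrakk>u \<in> verts N; v \<in> verts N\<rbrakk> \<Longrightarrow> (u, v) \<in> rtrancl_on (verts N) (parcs (mk_symmetric N))"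
    using assms(2)
    by (auto simp: Digraph_Component.connected_def strongly_connected_def reachable_def)
  show ?thesis
  proof
    fix \<phi> :: "'v \<Rightarrow> real" and u v
    assume \<phi>: "\<And>e. e \<in> arcs N \<Longrightarrow> \<phi> (tail N e) = \<phi> (head N e)"
      and uv: "u \<in> verts N" "v \<in> verts N"
    from conn(2)[OF uv] show "\<phi> u = \<phi> v"
      by (induction rule: rtrancl_on_induct) (auto simp: parcs_mk_symmetric \<phi>)
  qed (rule conn)
qed

definition potential_drop :: "('v, 'e) pre_digraph \<Rightarrow> real ^ 'v \<Rightarrow> 'e \<Rightarrow> real" where
  "potential_drop N \<phi> e = \<phi> $ tail N e - \<phi> $ head N e"

definition potential_flow ::
    "('v, 'e) pre_digraph \<Rightarrow> real ^ 'e \<Rightarrow> real ^ 'v \<Rightarrow> real ^ 'e" where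
  "potential_flow N w \<phi> = (\<chi> e. if e \<in> arcs N then w $ e * potential_drop N \<phi> e else 0)"

text \<open>For a connected network with vertex set \<open>V\<close> this is the orthogonal projection onto
  the kernel of its Laplacian: the constants on \<open>V\<close>, together with all coordinates off \<open>V\<close>,
  where the Laplacian is extended by zero.\<close>

definition averaging :: "'v set \<Rightarrow> real ^ 'v ^ 'v::finite" where
  "averaging V = (\<chi> i j. if i \<in> V \<and> j \<in> V then 1 / card V else if i = j then 1 else 0)"

lemma averaging_apply:
  "(averaging V *v x) $ i = (if i \<in> V then (\<Sum>j\<in>V. x $ j) / card V else x $ i)"
proof (cases "i \<in> V")
  case True
  have "(averaging V *v x) $ i = (\<Sum>j\<in>UNIV. if j \<in> V then x $ j / card V else 0)"
    using True by (auto simp: averaging_def matrix_vector_mult_def intro!: sum.cong)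
  also have "\<dots> = (\<Sum>j\<in>V. x $ j / card V)"
    by (simp add: sum.If_cases)
  finally show ?thesis using True by (simp add: sum_divide_distrib)
next
  case False
  then show ?thesis
    by (simp add: averaging_def matrix_vector_mult_def if_distrib[of "\<lambda>x. x * _"]
        cong: if_cong)
qed

lemma transpose_averaging: "transpose (averaging V) = averaging V"
  by (auto simp: averaging_def transpose_def vec_eq_iff)

lemma averaging_idempotent: "averaging V ** averaging V = averaging V"
proof (subst matrix_eq, intro allI)
  fix x :: "real ^ 'a"
  have *: "(\<Sum>j\<in>V. (averaging V *v x) $ j) = (\<Sum>j\<in>V. x $ j)"
    by (cases "V = {}") (simp_all add: averaging_apply)
  show "averaging V ** averaging V *v x = averaging V *v x"
    by (simp add: vec_eq_iff averaging_apply * flip: matrix_vector_mul_assoc)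
qed

lemma averaging_balanced:
  assumes "p \<in> coord_space V" "balanced p"
  shows "averaging V *v p = 0"
proof -
  have "(\<Sum>v\<in>V. p $ v) = (\<Sum>v\<in>UNIV. p $ v)"
    using assms(1) by (intro sum.mono_neutral_left) (auto simp: coord_space_def)
  then show ?thesis
    using assms by (auto simp: vec_eq_iff averaging_apply balanced_def coord_space_def)
qed

context flow_network
begin

lemma incidence_nth:
  "incidence N $ v $ e =
    (if e \<in> arcs N then (if v = tail N e then 1 else 0) - (if v = head N e then 1 else 0) else 0)"
  using no_loops[of e] by (auto simp: incidence_def)

lemma transpose_incidence_apply:
  "(transpose (incidence N) *v \<phi>) $ e = (if e \<in> arcs N then potential_drop N \<phi> e else 0)"
proof -
  have "(transpose (incidence N) *v \<phi>) $ e = (\<Sum>v\<in>UNIV. incidence N $ v $ e * \<phi> $ v)"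
    by (simp add: matrix_vector_mult_def transpose_def del: transpose_matrix_vector)
  also have "\<dots> = (if e \<in> arcs N then potential_drop N \<phi> e else 0)"
    by (simp add: incidence_nth left_diff_distrib sum_subtractf potential_drop_def
        if_distrib[of "\<lambda>x. x * _"] cong: if_cong)
  finally show ?thesis .
qed

lemma potential_flow_matrix:
  "diag_mat w *v (transpose (incidence N) *v \<phi>) = potential_flow N w \<phi>"
proof -
  have "(diag_mat w *v y) $ e = w $ e * y $ e" for y :: "real ^ 'e" and e
    by (simp add: matrix_vector_mult_def diag_mat_def if_distrib[of "\<lambda>x. x * _"] cong: if_cong)
  then show ?thesis
    by (simp add: vec_eq_iff transpose_incidence_apply potential_flow_def
        del: transpose_matrix_vector)
qed

lemma laplacian_apply: "laplacian N w *v \<phi> = incidence N *v potential_flow N w \<phi>"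
  by (simp add: laplacian_def potential_flow_matrix del: transpose_matrix_vector
      flip: matrix_vector_mul_assoc)

lemma dc_flow_potential:
  "dc_flow N w p = potential_flow N w (pseudoinverse (laplacian N w) *v p)"
  by (simp add: dc_flow_def potential_flow_matrix del: transpose_matrix_vector
      flip: matrix_vector_mul_assoc)

lemma energy:
  "\<phi> \<bullet> (laplacian N w *v \<psi>) = (\<Sum>e\<in>arcs N. w $ e * potential_drop N \<phi> e * potential_drop N \<psi> e)"
proof -
  have "\<phi> \<bullet> (laplacian N w *v \<psi>) = (transpose (incidence N) *v \<phi>) \<bullet> potential_flow N w \<psi>"
    by (simp add: laplacian_apply dot_lmul_matrix)
  also have "\<dots> = (\<Sum>e\<in>UNIV. if e \<in> arcs N then
      w $ e * potential_drop N \<phi> e * potential_drop N \<psi> e else 0)"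
    unfolding inner_vec_def
    by (intro sum.cong)
      (simp_all add: transpose_incidence_apply potential_flow_def del: transpose_matrix_vector)
  finally show ?thesis by (simp add: sum.If_cases)
qed

lemma transpose_laplacian: "transpose (laplacian N w) = laplacian N w"
proof -
  have "transpose (diag_mat w) = diag_mat w"
    by (auto simp: transpose_def diag_mat_def vec_eq_iff)
  then show ?thesis by (simp add: laplacian_def matrix_transpose_mul matrix_mul_assoc)
qed

lemma laplacian_averaging: "laplacian N w ** averaging (verts N) = 0"
proof (subst matrix_eq, intro allI)
  fix x
  have "potential_flow N w (averaging (verts N) *v x) = 0"
    by (simp add: vec_eq_iff potential_flow_def potential_drop_def averaging_apply)
  then show "laplacian N w ** averaging (verts N) *v x = 0 *v x"
    by (simp add: laplacian_apply flip: matrix_vector_mul_assoc)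
qed

text \<open>With positive weights every arc contributes a nonnegative energy, so none may
  contribute at all. Hence the kernel of the Laplacian consists of the potentials without
  drops.\<close>

lemma zero_energy_drop:
  assumes w: "\<And>e. e \<in> arcs N \<Longrightarrow> 0 < w $ e"
    and "\<phi> \<bullet> (laplacian N w *v \<phi>) \<le> 0" and e: "e \<in> arcs N"
  shows "potential_drop N \<phi> e = 0"
proof -
  let ?q = "\<lambda>e. w $ e * potential_drop N \<phi> e * potential_drop N \<phi> e"
  have nonneg: "0 \<le> ?q e" if "e \<in> arcs N" for e
    unfolding mult.assoc using w[OF that] by (intro mult_nonneg_nonneg zero_le_square) simp
  then have "0 \<le> sum ?q (arcs N)" by (rule sum_nonneg)
  then have "sum ?q (arcs N) = 0"
    using assms(2) unfolding energy by linarith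
  then have "\<forall>e\<in>arcs N. ?q e = 0"
    using sum_nonneg_eq_0_iff[of "arcs N" ?q] nonneg by simp
  then have "?q e = 0" using e by blast
  then show ?thesis using w[OF e] by simp
qed

lemma invertible_shifted_laplacian:
  assumes w: "\<And>e. e \<in> arcs N \<Longrightarrow> 0 < w $ e"
  shows "invertible (laplacian N w + averaging (verts N))"
proof -
  let ?P = "averaging (verts N)"
  have "x = 0" if "(laplacian N w + ?P) *v x = 0" for x
  proof -
    have "?P *v ((laplacian N w + ?P) *v x) = ?P *v x"
    proof -
      have "?P ** laplacian N w = 0"
        using arg_cong[OF laplacian_averaging, of transpose]
        by (simp add: matrix_transpose_mul transpose_laplacian transpose_averaging
            transpose_zero)
      then show ?thesis
        by (simp add: matrix_vector_mul_assoc matrix_add_ldistrib averaging_idempotent)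
    qed
    then have Px: "?P *v x = 0" using that by simp
    then have "laplacian N w *v x = 0"
      using that by (simp add: matrix_vector_mult_add_rdistrib)
    then have "potential_drop N x e = 0" if "e \<in> arcs N" for e
      using zero_energy_drop[OF w, of x e] that by simp
    then have drop: "x $ tail N e = x $ head N e" if "e \<in> arcs N" for e
      using that by (simp add: potential_drop_def)
    have const: "x $ u = x $ v" if "u \<in> verts N" "v \<in> verts N" for u v
      by (rule potential_constant[of "($) x"]) (rule drop that, assumption?)+
    show "x = 0"
    proof (subst vec_eq_iff, intro allI)
      fix v
      show "x $ v = 0 $ v"
      proof (cases "v \<in> verts N")
        case True
        then have "(\<Sum>u\<in>verts N. x $ u) = (\<Sum>u\<in>verts N. x $ v)"
          by (intro sum.cong refl const)
        then have "(?P *v x) $ v = x $ v"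
          using True verts_nonempty by (simp add: averaging_apply)
        then show ?thesis using Px by simp
      next
        case False
        then have "(?P *v x) $ v = x $ v" by (simp add: averaging_apply)
        then show ?thesis using Px by simp
      qed
    qed
  qed
  then show ?thesis
    unfolding invertible_left_inverse matrix_left_invertible_ker by blast
qed

lemmas pseudoinverse_laplacian =
  pseudoinverse_via_kernel_projection[OF transpose_laplacian transpose_averaging
    averaging_idempotent laplacian_averaging invertible_shifted_laplacian]

lemma laplacian_pseudoinverse_balanced:
  assumes w: "\<And>e. e \<in> arcs N \<Longrightarrow> 0 < w $ e"
    and p: "p \<in> coord_space (verts N)" "balanced p"
  shows "laplacian N w *v (pseudoinverse (laplacian N w) *v p) = p"
proof -
  have "(mat 1 - averaging (verts N)) *v p = p"
    using averaging_balanced[OF p] by (simp add: matrix_vector_mult_diff_rdistrib)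
  then show ?thesis
    using pseudoinverse_laplacian(2)[OF w] by (simp add: matrix_vector_mul_assoc)
qed

lemma dc_flow_conservation:
  assumes "\<And>e. e \<in> arcs N \<Longrightarrow> 0 < w $ e"
    and "p \<in> coord_space (verts N)" "balanced p"
  shows "incidence N *v dc_flow N w p = p"
  using laplacian_pseudoinverse_balanced[OF assms] by (simp add: dc_flow_potential laplacian_apply)

text \<open>The flow is determined by its divergence: two potentials with the same divergence differ
  by one of zero energy.\<close>

lemma dc_flow_eqI:
  assumes w: "\<And>e. e \<in> arcs N \<Longrightarrow> 0 < w $ e"
    and p: "p \<in> coord_space (verts N)" "balanced p"
    and div: "incidence N *v potential_flow N w \<phi> = p"
  shows "dc_flow N w p = potential_flow N w \<phi>"
proof -
  define \<psi> where "\<psi> = pseudoinverse (laplacian N w) *v p"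
  have "laplacian N w *v (\<psi> - \<phi>) = 0"
    using laplacian_pseudoinverse_balanced[OF w p] div
    by (simp add: \<psi>_def laplacian_apply matrix_vector_mult_diff_distrib)
  then have "potential_drop N (\<psi> - \<phi>) e = 0" if "e \<in> arcs N" for e
    using zero_energy_drop[OF w, of "\<psi> - \<phi>" e] that by simp
  then have "potential_drop N \<psi> e = potential_drop N \<phi> e" if "e \<in> arcs N" for e
    using that by (fastforce simp: potential_drop_def)
  then show ?thesis
    by (simp add: dc_flow_potential potential_flow_def vec_eq_iff flip: \<psi>_def)
qed

lemma continuous_on_pseudoinverse_laplacian:
  "continuous_on {w. \<forall>e\<in>arcs N. 0 < w $ e} (\<lambda>w. pseudoinverse (laplacian N w) *v p)"
proof -
  let ?S = "{w. \<forall>e\<in>arcs N. 0 < w $ e}" and ?P = "averaging (verts N)"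
  have entry: "laplacian N w $ i $ j =
      (\<Sum>e\<in>UNIV. incidence N $ i $ e * w $ e * incidence N $ j $ e)" for w i j
  proof -
    have "(incidence N ** diag_mat w) $ i $ e = incidence N $ i $ e * w $ e" for e
      by (simp add: matrix_matrix_mult_def diag_mat_def if_distrib cong: if_cong)
    then show ?thesis
      unfolding laplacian_def by (subst matrix_matrix_mult_def) (simp add: transpose_def)
  qed
  have "continuous_on ?S (\<lambda>w. matrix_inv (laplacian N w + ?P) *v p)"
    by (rule continuous_on_matrix_inv_vector)
      (auto simp: entry intro!: continuous_intros invertible_shifted_laplacian)
  then have "continuous_on ?S (\<lambda>w. matrix_inv (laplacian N w + ?P) *v p - ?P *v p)"
    by (intro continuous_intros)
  then show ?thesis
    by (rule continuous_on_eq)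
      (auto simp: pseudoinverse_laplacian(1) matrix_vector_mult_diff_rdistrib)
qed

lemma continuous_on_dc_flow:
  "continuous_on {w. \<forall>e\<in>arcs N. 0 < w $ e} (\<lambda>w. dc_flow N w p)"
proof -
  have "continuous_on {w. \<forall>e\<in>arcs N. 0 < w $ e} (\<lambda>w. if e \<in> arcs N
      then w $ e * potential_drop N (pseudoinverse (laplacian N w) *v p) e else 0)" for e
    by (cases "e \<in> arcs N")
      (auto simp: potential_drop_def
        intro!: continuous_intros continuous_on_pseudoinverse_laplacian)
  then show ?thesis
    unfolding dc_flow_potential potential_flow_def by (intro continuous_on_vec_lambda)
qed

text \<open>An incidence matrix has entries of absolute value at most one, so capacities bound what
  a flow can supply to any vertex.\<close>

lemma divergence_bound:
  assumes "l \<le> f" "f \<le> u"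
  shows "\<bar>(incidence N *v f) $ v\<bar> \<le> (\<Sum>e\<in>UNIV. \<bar>l $ e\<bar> + \<bar>u $ e\<bar>)"
proof -
  have "\<bar>(incidence N *v f) $ v\<bar> \<le> (\<Sum>e\<in>UNIV. \<bar>incidence N $ v $ e * f $ e\<bar>)"
    unfolding matrix_vector_mult_def by (simp add: sum_abs)
  also have "\<dots> \<le> (\<Sum>e\<in>UNIV. \<bar>l $ e\<bar> + \<bar>u $ e\<bar>)"
  proof (rule sum_mono)
    fix e
    have "\<bar>incidence N $ v $ e * f $ e\<bar> \<le> \<bar>f $ e\<bar>" by (simp add: incidence_nth)
    moreover have "l $ e \<le> f $ e" "f $ e \<le> u $ e"
      using assms by (simp_all add: less_eq_vec_def)
    ultimately show "\<bar>incidence N $ v $ e * f $ e\<bar> \<le> \<bar>l $ e\<bar> + \<bar>u $ e\<bar>" by linarith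
  qed
  finally show ?thesis .
qed

lemma dc_flow_linear: "dc_flow N w (p + t *\<^sub>R q) = dc_flow N w p + t *\<^sub>R dc_flow N w q"
  unfolding dc_flow_def
  by (simp only: linear_add[OF matrix_vector_mul_linear] linear_scale[OF matrix_vector_mul_linear])

end


section \<open>The equivalent weight between two terminals\<close>

lemma unit_transfer_inner:
  assumes "s \<noteq> t"
  shows "unit_transfer s t \<bullet> x = x $ s - x $ t"
proof -
  have "unit_transfer s t \<bullet> x =
      (\<Sum>v\<in>UNIV. (if v = s then x $ v else 0) - (if v = t then x $ v else 0))"
    unfolding inner_vec_def using assms by (intro sum.cong) (auto simp: unit_transfer_def)
  then show ?thesis by (simp add: sum_subtractf)
qed

lemma balanced_unit_transfer: "s \<noteq> t \<Longrightarrow> balanced (unit_transfer s t)"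
  using unit_transfer_inner[of s t "\<chi> v. 1"] by (simp add: balanced_def inner_vec_def)

context flow_network
begin

context
  fixes s t
  assumes terminals: "s \<in> verts N" "t \<in> verts N" "s \<noteq> t"
begin

abbreviation "transfer_potential w \<equiv> pseudoinverse (laplacian N w) *v unit_transfer s t"

lemma unit_transfer_supported: "unit_transfer s t \<in> coord_space (verts N)"
  using terminals by (auto simp: coord_space_def unit_transfer_def)

lemmas laplacian_transfer_potential =
  laplacian_pseudoinverse_balanced[OF _ unit_transfer_supported balanced_unit_transfer[OF terminals(3)]]

lemmas transfer_flow_conservation =
  dc_flow_conservation[OF _ unit_transfer_supported balanced_unit_transfer[OF terminals(3)]]

lemma equiv_weight_potential:
  "equiv_weight N s t w = 1 / (transfer_potential w $ s - transfer_potential w $ t)"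
  by (simp add: equiv_weight_def unit_transfer_inner terminals)

lemma resistance_pos:
  assumes w: "\<And>e. e \<in> arcs N \<Longrightarrow> 0 < w $ e"
  shows "0 < unit_transfer s t \<bullet> transfer_potential w"
proof (rule ccontr)
  assume "\<not> ?thesis"
  then have "transfer_potential w \<bullet> (laplacian N w *v transfer_potential w) \<le> 0"
    by (simp add: laplacian_transfer_potential[OF w] inner_commute)
  then have "potential_drop N (transfer_potential w) e = 0" if "e \<in> arcs N" for e
    using zero_energy_drop[OF w] that by blast
  then have "potential_flow N w (transfer_potential w) = 0"
    by (simp add: potential_flow_def vec_eq_iff)
  then have "unit_transfer s t = (0 :: real ^ 'v)"
    using laplacian_transfer_potential[of w] w by (simp add: laplacian_apply)
  then show False
    by (auto simp: vec_eq_iff unit_transfer_def split: if_splits)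
qed

lemma equiv_weight_pos:
  assumes "\<And>e. e \<in> arcs N \<Longrightarrow> 0 < w $ e"
  shows "0 < equiv_weight N s t w"
  using resistance_pos[OF assms] by (simp add: equiv_weight_def)

text \<open>Rayleigh's monotonicity law. The potential of the network with weights \<open>w\<close> minimises
  $\frac12\varphi^{\mathrm T} L\varphi - a^{\mathrm T}\varphi$; expanding the nonnegative energy
  of the difference of the two potentials is this minimality, tested with the potential of the
  network with weights \<open>w'\<close>.\<close>

lemma equiv_weight_mono:
  assumes w: "\<And>e. e \<in> arcs N \<Longrightarrow> 0 < w $ e" and le: "\<And>e. e \<in> arcs N \<Longrightarrow> w $ e \<le> w' $ e"
  shows "equiv_weight N s t w \<le> equiv_weight N s t w'"
proof -
  let ?a = "unit_transfer s t" and ?\<phi> = "transfer_potential w" and ?\<phi>' = "transfer_potential w'"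
  have w': "0 < w' $ e" if "e \<in> arcs N" for e
    using w[OF that] le[OF that] by simp
  have L: "laplacian N w *v ?\<phi> = ?a" "laplacian N w' *v ?\<phi>' = ?a"
    using w w' by (auto intro: laplacian_transfer_potential)
  have "0 \<le> (?\<phi> - ?\<phi>') \<bullet> (laplacian N w *v (?\<phi> - ?\<phi>'))"
    unfolding energy mult.assoc using w less_imp_le
    by (intro sum_nonneg mult_nonneg_nonneg zero_le_square) blast
  also have "\<dots> = ?\<phi> \<bullet> ?a - ?\<phi>' \<bullet> ?a - ?\<phi> \<bullet> (laplacian N w *v ?\<phi>')
      + ?\<phi>' \<bullet> (laplacian N w *v ?\<phi>')"
    by (simp add: matrix_vector_mult_diff_distrib L inner_diff_left inner_diff_right)
  also have "?\<phi> \<bullet> (laplacian N w *v ?\<phi>') = ?\<phi>' \<bullet> (laplacian N w *v ?\<phi>)"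
    by (simp add: energy mult_ac)
  also have "\<dots> = ?\<phi>' \<bullet> ?a" by (simp add: L)
  also have "?\<phi>' \<bullet> (laplacian N w *v ?\<phi>') \<le> ?\<phi>' \<bullet> (laplacian N w' *v ?\<phi>')"
    unfolding energy mult.assoc using le
    by (intro sum_mono mult_right_mono zero_le_square) blast
  also have "\<dots> = ?\<phi>' \<bullet> ?a" by (simp add: L)
  finally have "?a \<bullet> ?\<phi>' \<le> ?a \<bullet> ?\<phi>" by (simp add: inner_commute)
  then show ?thesis
    unfolding equiv_weight_def using resistance_pos[of w'] w'
    by (intro divide_left_mono) auto
qed

lemma continuous_on_equiv_weight:
  "continuous_on {w. \<forall>e\<in>arcs N. 0 < w $ e} (equiv_weight N s t)"
  unfolding equiv_weight_def[abs_def]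
  by (intro continuous_intros continuous_on_pseudoinverse_laplacian ballI)
    (use resistance_pos in force)

end
end


section \<open>Replacing one part of the network by a virtual link\<close>

lemma connected_subnetwork:
  fixes G H :: "('v::finite, 'e::finite) pre_digraph"
  assumes "loopfree_digraph G" "subgraph H G" "weakly_connected H"
  shows "flow_network H"
proof (rule weakly_connected_flow_network)
  interpret G: loopfree_digraph G by fact
  interpret H: wf_digraph H using assms(2) by (simp add: subgraph_def)
  show "loopfree_digraph H"
    using assms(2) G.no_loops by unfold_locales (auto simp: subgraph_def compatible_def)
qed fact

locale two_terminal_partition =
  fixes G G1 G2 :: "('v::finite, 'e::finite) pre_digraph" and v1 v2 :: 'v and p0 :: "real ^ 'v"
  assumes loopfree: "loopfree_digraph G" and connected: "weakly_connected G"
    and reducible: "reducible_via G v1 v2 p0 G1 G2"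
begin

lemma partition:
  "v1 \<noteq> v2" "verts G1 \<inter> verts G2 = {v1, v2}"
  "arcs G1 \<union> arcs G2 = arcs G" "arcs G1 \<inter> arcs G2 = {}"
  "tail G1 = tail G" "head G1 = head G" "tail G2 = tail G" "head G2 = head G"
  and p0_supported: "p0 \<in> coord_space (verts G1)"
  and verts_part1: "verts G1 \<subseteq> verts G" and arcs_part1: "arcs G1 \<subseteq> arcs G"
  using reducible by (auto simp: reducible_via_def subgraph_def compatible_def)

lemma terminals: "v1 \<in> verts G1" "v2 \<in> verts G1" "v1 \<in> verts G2" "v2 \<in> verts G2"
  using partition(2) by auto

sublocale whole: flow_network G
  using loopfree connected by (rule weakly_connected_flow_network)

sublocale part1: flow_network G1
  using loopfree reducible by (intro connected_subnetwork) (auto simp: reducible_via_def)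

sublocale part2: flow_network G2
  using loopfree reducible by (intro connected_subnetwork) (auto simp: reducible_via_def)

abbreviation "reduction \<equiv> add_virtual_link G1 v1 v2"

lemma reduction_simps [simp]:
  "verts reduction = verts G1" "arcs reduction = insert None (Some ` arcs G1)"
  "tail reduction None = v1" "head reduction None = v2"
  "tail reduction (Some e) = tail G e" "head reduction (Some e) = head G e"
  by (simp_all add: add_virtual_link_def partition)

sublocale reduced: flow_network reduction
proof
  show "tail reduction e \<in> verts reduction" "head reduction e \<in> verts reduction"
      "tail reduction e \<noteq> head reduction e" if "e \<in> arcs reduction" for e
    using that terminals partition(1) part1.no_loops part1.tail_in_verts part1.head_in_verts
    by (auto simp: partition)
  show "verts reduction \<noteq> {}" using terminals by auto
next
  fix \<phi> :: "'v \<Rightarrow> real" and u v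
  assume \<phi>: "\<And>e. e \<in> arcs reduction \<Longrightarrow> \<phi> (tail reduction e) = \<phi> (head reduction e)"
    and "u \<in> verts reduction" "v \<in> verts reduction"
  moreover have "\<phi> (tail G1 e) = \<phi> (head G1 e)" if "e \<in> arcs G1" for e
    using \<phi>[of "Some e"] that by (simp add: partition)
  ultimately show "\<phi> u = \<phi> v" using part1.potential_constant[of \<phi> u v] by simp
qed

lemmas terminals2 = terminals(3,4) partition(1)

text \<open>
  Seen from its terminals the second part behaves like a single link of the equivalent weight:
  no power enters at its inner vertices, so it carries a multiple of its unit transfer
  flow. Accordingly the potential of the reduction extends to the whole network by an affine
  image of the transfer potential; the equivalent weight is exactly what makes the two agree at
  both terminals. The divergence of the extension is \<open>p\<close>, and a potential flow is determined by
  its divergence.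
\<close>

lemma dc_flow_reduction:
  assumes w: "\<And>e. e \<in> arcs G \<Longrightarrow> 0 < w $ e"
    and p: "p \<in> coord_space (verts G1)" "balanced p"
  defines "f \<equiv> dc_flow reduction (add_virtual_weight (subvec (arcs G1) w)
      (equiv_weight G2 v1 v2 (subvec (arcs G2) w))) p"
  shows "dc_flow G w p = (\<chi> e. if e \<in> arcs G1 then f $ Some e
      else f $ None * dc_flow G2 (subvec (arcs G2) w) (unit_transfer v1 v2) $ e)"
    (is "_ = ?F")
proof -
  define w2 where "w2 = subvec (arcs G2) w"
  define weq where "weq = equiv_weight G2 v1 v2 w2"
  define w' where "w' = add_virtual_weight (subvec (arcs G1) w) weq"
  define \<psi> where "\<psi> = pseudoinverse (laplacian G2 w2) *v unit_transfer v1 v2"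
  define \<theta> where "\<theta> = pseudoinverse (laplacian reduction w') *v p"
  define z where "z = f $ None"
  define fa where "fa = dc_flow G2 w2 (unit_transfer v1 v2)"
  have w2: "0 < w2 $ e" if "e \<in> arcs G2" for e
    using w that partition(3) by (auto simp: w2_def subvec_def)
  have weq: "weq = 1 / (\<psi> $ v1 - \<psi> $ v2)" "0 < weq"
    using part2.equiv_weight_pos[OF terminals2 w2]
    by (simp_all add: weq_def \<psi>_def part2.equiv_weight_potential[OF terminals2])
  have w': "0 < w' $ e" if "e \<in> arcs reduction" for e
    using that w weq(2) arcs_part1 by (auto simp: w'_def add_virtual_weight_def subvec_def)
  have f: "f = potential_flow reduction w' \<theta>"
    by (simp add: f_def w'_def weq_def w2_def \<theta>_def reduced.dc_flow_potential)
  have fa: "fa = potential_flow G2 w2 \<psi>"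
    by (simp add: fa_def \<psi>_def part2.dc_flow_potential)
  have z: "z = weq * (\<theta> $ v1 - \<theta> $ v2)"
    by (simp add: z_def f potential_flow_def potential_drop_def w'_def add_virtual_weight_def)
  define \<phi> where
    "\<phi> = (\<chi> v. if v \<in> verts G1 then \<theta> $ v else z * (\<psi> $ v - \<psi> $ v2) + \<theta> $ v2)"
  have \<phi>1: "\<phi> $ v = \<theta> $ v" if "v \<in> verts G1" for v
    using that by (simp add: \<phi>_def)
  have \<phi>2: "\<phi> $ v = z * (\<psi> $ v - \<psi> $ v2) + \<theta> $ v2" if "v \<in> verts G2" for v
  proof (cases "v \<in> verts G1")
    case True
    have "z * (\<psi> $ v1 - \<psi> $ v2) = \<theta> $ v1 - \<theta> $ v2"
      using weq by (auto simp: z)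
    moreover from True that partition(2) have "v = v1 \<or> v = v2" by blast
    ultimately show ?thesis using \<phi>1[OF True] by auto
  qed (simp add: \<phi>_def)
  have F: "?F = potential_flow G w \<phi>"
  proof (subst vec_eq_iff, intro allI)
    fix e
    consider "e \<in> arcs G1" | "e \<in> arcs G2" "e \<notin> arcs G1" | "e \<notin> arcs G"
      using partition(3) by blast
    then show "?F $ e = potential_flow G w \<phi> $ e"
    proof cases
      case 1
      then have "tail G e \<in> verts G1" "head G e \<in> verts G1" "e \<in> arcs G"
        using part1.tail_in_verts[of e] part1.head_in_verts[of e] partition by auto
      then show ?thesis
        using 1 by (simp add: f potential_flow_def potential_drop_def \<phi>1 w'_def
            add_virtual_weight_def subvec_def)
    next
      case 2
      then have "tail G e \<in> verts G2" "head G e \<in> verts G2" "e \<in> arcs G"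
        using part2.tail_in_verts[of e] part2.head_in_verts[of e] partition by auto
      then show ?thesis
        using 2 by (simp add: fa potential_flow_def potential_drop_def \<phi>2 partition
            flip: fa_def w2_def z_def) (simp add: w2_def subvec_def algebra_simps)
    next
      case 3
      then have "e \<notin> arcs G1" "e \<notin> arcs G2" using partition(3) by auto
      then show ?thesis using 3 by (simp add: potential_flow_def fa flip: fa_def w2_def)
    qed
  qed
  have "incidence G *v ?F = p"
  proof (subst vec_eq_iff, intro allI)
    fix v
    have split: "incidence G $ v $ e * (if e \<in> arcs G1 then f $ Some e
          else f $ None * dc_flow G2 (subvec (arcs G2) w) (unit_transfer v1 v2) $ e) =
        incidence G1 $ v $ e * f $ Some e + z * (incidence G2 $ v $ e * fa $ e)" for e
    proof -
      consider "e \<in> arcs G1" "e \<notin> arcs G2" "e \<in> arcs G"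
        | "e \<in> arcs G2" "e \<notin> arcs G1" "e \<in> arcs G"
        | "e \<notin> arcs G1" "e \<notin> arcs G2" "e \<notin> arcs G"
        using partition(3,4) by blast
      then show ?thesis
        by cases (simp_all add: whole.incidence_nth part1.incidence_nth part2.incidence_nth
            partition(5-8) flip: fa_def w2_def z_def)
    qed
    have "p $ v = (incidence reduction *v f) $ v"
      using reduced.dc_flow_conservation[OF w', of p] p
      by (simp add: f_def w'_def weq_def w2_def)
    also have "\<dots> = z * incidence reduction $ v $ None
        + (\<Sum>e\<in>UNIV. incidence reduction $ v $ Some e * f $ Some e)"
      by (simp add: matrix_vector_mult_def UNIV_option_conv sum.reindex z_def)
    also have "\<dots> = z * unit_transfer v1 v2 $ v
        + (\<Sum>e\<in>UNIV. incidence G1 $ v $ e * f $ Some e)"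
    proof -
      have "incidence reduction $ v $ None = unit_transfer v1 v2 $ v"
        using partition(1) by (simp add: reduced.incidence_nth unit_transfer_def)
      moreover have "incidence reduction $ v $ Some e = incidence G1 $ v $ e" for e
        by (auto simp: reduced.incidence_nth part1.incidence_nth partition)
      ultimately show ?thesis by simp
    qed
    also have "unit_transfer v1 v2 $ v = (\<Sum>e\<in>UNIV. incidence G2 $ v $ e * fa $ e)"
      using part2.transfer_flow_conservation[OF terminals2 w2]
      by (simp add: fa_def vec_eq_iff matrix_vector_mult_def)
    finally show "(incidence G *v ?F) $ v = p $ v"
      by (simp add: matrix_vector_mult_def split sum.distrib flip: sum_distrib_left)
  qed
  moreover have "p \<in> coord_space (verts G)"
    using p(1) verts_part1 by (auto simp: coord_space_def)
  ultimately have "dc_flow G w p = potential_flow G w \<phi>"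
    using p(2) by (intro whole.dc_flow_eqI w) (simp_all add: F)
  then show ?thesis using F by simp
qed

end


section \<open>Compactness\<close>

text \<open>The feasible scalars are a projection of the feasible pairs, which form a compact set
  once the scalars are bounded.\<close>

lemma compact_affine_feasible:
  fixes F0 F :: "'a::metric_space \<Rightarrow> real ^ 'i::finite"
  assumes S: "compact S" and cont: "continuous_on S F0" "continuous_on S F"
    and bound: "\<And>x t. \<lbrakk>x \<in> S; l \<le> F0 x + t *\<^sub>R F x; F0 x + t *\<^sub>R F x \<le> u\<rbrakk> \<Longrightarrow> \<bar>t\<bar> \<le> K"
  shows "compact {t. \<exists>x\<in>S. l \<le> F0 x + t *\<^sub>R F x \<and> F0 x + t *\<^sub>R F x \<le> u}"
proof -
  let ?h = "\<lambda>(x, t). F0 x + t *\<^sub>R F x" and ?D = "S \<times> {- K..K}"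
  have "continuous_on ?D ?h"
    unfolding split_def
    by (intro continuous_intros continuous_on_compose2[OF cont(1) continuous_on_fst]
        continuous_on_compose2[OF cont(2) continuous_on_fst]) auto
  moreover have D: "compact ?D" using S by (intro compact_Times) auto
  ultimately have "closed (?D \<inter> ?h -` cbox l u)"
    by (intro continuous_closed_preimage compact_imp_closed closed_cbox)
  then have "compact (?D \<inter> ?h -` cbox l u)"
    by (rule compact_Int_closed[OF D, THEN subst[OF Int_left_absorb, of compact]])
  then have "compact (snd ` (?D \<inter> ?h -` cbox l u))"
    by (intro compact_continuous_image continuous_intros)
  also have "snd ` (?D \<inter> ?h -` cbox l u) =
      {t. \<exists>x\<in>S. l \<le> F0 x + t *\<^sub>R F x \<and> F0 x + t *\<^sub>R F x \<le> u}"
  proof -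
    have "t \<in> {- K..K}" if "x \<in> S" "l \<le> F0 x + t *\<^sub>R F x" "F0 x + t *\<^sub>R F x \<le> u" for x t
      using bound[OF that] by (simp add: abs_le_iff minus_le_iff)
    then show ?thesis
      by (auto simp: cbox_interval image_iff Bex_def)
  qed
  finally show ?thesis .
qed

lemma is_max_of_compact: "\<lbrakk>compact S; S \<noteq> {}\<rbrakk> \<Longrightarrow> \<exists>m. is_max_of S m"
  using compact_attains_sup[of S] by (auto simp: is_max_of_def)

lemma is_min_of_compact: "\<lbrakk>compact S; S \<noteq> {}\<rbrakk> \<Longrightarrow> \<exists>m. is_min_of S m"
  using compact_attains_inf[of S] by (auto simp: is_min_of_def)

lemma Greatest_is_max_of: "is_max_of S m \<Longrightarrow> (GREATEST x. x \<in> S) = m"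
  by (rule Greatest_equality) (auto simp: is_max_of_def)

lemma Least_is_min_of: "is_min_of S m \<Longrightarrow> (LEAST x. x \<in> S) = m"
  by (rule Least_equality) (auto simp: is_min_of_def)

lemma subvec_nth: "subvec S x $ i = (if i \<in> S then x $ i else 0)"
  by (simp add: subvec_def)

lemma subvec_mono: "x \<le> y \<Longrightarrow> subvec S x \<le> subvec S y"
  by (simp add: less_eq_vec_def subvec_nth)

lemma subvec_coord_space: "x \<in> coord_space S \<Longrightarrow> subvec S x = x"
  by (auto simp: vec_eq_iff subvec_nth coord_space_def)

locale bounded_partition = two_terminal_partition G G1 G2 v1 v2 p0
  for G G1 G2 :: "('v::finite, 'e::finite) pre_digraph" and v1 v2 p0 +
  fixes wl wu cl cu :: "real ^ 'e"
  assumes coord: "wl \<in> coord_space (arcs G)" "wu \<in> coord_space (arcs G)"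
      "cl \<in> coord_space (arcs G)" "cu \<in> coord_space (arcs G)"
    and wl_pos: "e \<in> arcs G \<Longrightarrow> 0 < wl $ e" and wl_le: "wl \<le> wu"
    and cl_neg: "e \<in> arcs G \<Longrightarrow> cl $ e < 0" and cu_pos: "e \<in> arcs G \<Longrightarrow> 0 < cu $ e"
begin

abbreviation "box2 \<equiv> {subvec (arcs G2) wl..subvec (arcs G2) wu}"
abbreviation "H \<equiv> equiv_weight G2 v1 v2"
abbreviation "unit_flow w2 \<equiv> dc_flow G2 w2 (unit_transfer v1 v2)"
abbreviation "transfers \<equiv> transfer_set G2 v1 v2 wl wu cl cu"

lemma arcs_part2: "arcs G2 \<subseteq> arcs G"
  using partition(3) by auto

lemma box_pos: "\<lbrakk>w \<in> {wl..wu}; e \<in> arcs G\<rbrakk> \<Longrightarrow> 0 < w $ e"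
  using wl_pos[of e] by (auto simp: less_eq_vec_def intro: less_le_trans)

lemma box2_pos: "\<lbrakk>w2 \<in> box2; e \<in> arcs G2\<rbrakk> \<Longrightarrow> 0 < w2 $ e"
  using wl_pos[of e] arcs_part2
  by (auto simp: less_eq_vec_def subvec_nth dest!: spec[of _ e] intro: less_le_trans)

lemma compact_box2: "compact box2"
  by (metis cbox_interval compact_cbox)

lemma continuous_on_box2:
  "continuous_on box2 H" "continuous_on box2 unit_flow"
  by (rule continuous_on_subset[OF part2.continuous_on_equiv_weight[OF terminals2]]
      continuous_on_subset[OF part2.continuous_on_dc_flow]; use box2_pos in blast)+

text \<open>The equivalent weights of the box fill the whole interval between those of its two
  extreme corners: they lie in it by monotonicity, and attain every value by connectedness.\<close>

lemma equiv_weight_box: "H ` box2 = equiv_weight_range G2 v1 v2 wl wu"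
proof
  show "H ` box2 \<subseteq> equiv_weight_range G2 v1 v2 wl wu"
  proof
    fix x assume "x \<in> H ` box2"
    then obtain w2 where w2: "w2 \<in> box2" "x = H w2" by blast
    have "subvec (arcs G2) wl \<in> box2"
      using subvec_mono[OF wl_le] by simp
    then have "H (subvec (arcs G2) wl) \<le> H w2" "H w2 \<le> H (subvec (arcs G2) wu)"
      using w2 by (auto intro!: part2.equiv_weight_mono[OF terminals2]
          intro: box2_pos simp: less_eq_vec_def)
    then show "x \<in> equiv_weight_range G2 v1 v2 wl wu"
      using w2 by (simp add: equiv_weight_range_def)
  qed
next
  have "Topological_Spaces.connected box2"
    using convex_connected[OF convex_box(1)[of "subvec (arcs G2) wl" "subvec (arcs G2) wu"]]
    by (simp add: cbox_interval)
  with continuous_on_box2(1) have "Topological_Spaces.connected (H ` box2)"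
    by (rule connected_continuous_image)
  then show "equiv_weight_range G2 v1 v2 wl wu \<subseteq> H ` box2"
    unfolding equiv_weight_range_def using subvec_mono[OF wl_le]
    by (intro connected_contains_Icc) auto
qed

lemma compact_transfers: "compact (transfers weq)"
proof -
  let ?S = "{w2 \<in> box2. H w2 = weq}"
  let ?l = "subvec (arcs G2) cl" and ?u = "subvec (arcs G2) cu"
  have "closed (box2 \<inter> H -` {weq})"
    using continuous_on_box2(1) compact_box2
    by (intro continuous_closed_preimage compact_imp_closed) auto
  then have "compact (box2 \<inter> (box2 \<inter> H -` {weq}))"
    by (intro compact_Int_closed compact_box2)
  also have "box2 \<inter> (box2 \<inter> H -` {weq}) = ?S" by auto
  finally have S: "compact ?S" .
  have "compact {z. \<exists>w2\<in>?S. ?l \<le> 0 + z *\<^sub>R unit_flow w2 \<and> 0 + z *\<^sub>R unit_flow w2 \<le> ?u}"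
  proof (rule compact_affine_feasible[OF S])
    show "continuous_on ?S unit_flow"
      using continuous_on_box2(2) by (rule continuous_on_subset) auto
    fix w2 z
    assume w2: "w2 \<in> ?S" and *: "?l \<le> 0 + z *\<^sub>R unit_flow w2" "0 + z *\<^sub>R unit_flow w2 \<le> ?u"
    \<comment> \<open>the amount transferred is what leaves the first terminal\<close>
    have "incidence G2 *v unit_flow w2 = unit_transfer v1 v2"
      using w2 by (intro part2.transfer_flow_conservation[OF terminals2]) (auto intro: box2_pos)
    then have "(incidence G2 *v (z *\<^sub>R unit_flow w2)) $ v1 = z"
      by (simp add: linear_scale[OF matrix_vector_mul_linear] unit_transfer_def)
    then show "\<bar>z\<bar> \<le> (\<Sum>e\<in>UNIV. \<bar>?l $ e\<bar> + \<bar>?u $ e\<bar>)"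
      using part2.divergence_bound[OF *, of v1] by simp
  qed simp
  also have "{z. \<exists>w2\<in>?S. ?l \<le> 0 + z *\<^sub>R unit_flow w2 \<and> 0 + z *\<^sub>R unit_flow w2 \<le> ?u}
      = transfers weq"
    by (auto simp: transfer_set_def)
  finally show ?thesis .
qed

lemma zero_transfer:
  assumes "weq \<in> equiv_weight_range G2 v1 v2 wl wu"
  shows "0 \<in> transfers weq"
proof -
  have "weq \<in> H ` box2"
    using assms by (simp only: equiv_weight_box)
  then obtain w2 where w2: "w2 \<in> box2" "H w2 = weq"
    by (elim imageE) simp
  have "subvec (arcs G2) cl $ e \<le> 0 \<and> 0 \<le> subvec (arcs G2) cu $ e" for e
    using cl_neg[of e] cu_pos[of e] arcs_part2 by (auto simp: subvec_nth)
  then have "subvec (arcs G2) cl \<le> 0" "0 \<le> subvec (arcs G2) cu"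
    by (simp_all add: less_eq_vec_def)
  then show ?thesis
    unfolding transfer_set_def mem_Collect_eq using w2 by (intro bexI[of _ w2]) simp_all
qed

text \<open>With the same weights, any fraction of a transfer is again a transfer, because the
  capacity bounds enclose zero.\<close>

lemma transfer_scale:
  assumes z: "z \<in> transfers weq" and t: "0 \<le> t" "t \<le> 1"
  shows "t * z \<in> transfers weq"
proof -
  obtain w2 where w2: "w2 \<in> box2" "H w2 = weq"
      "subvec (arcs G2) cl \<le> z *\<^sub>R unit_flow w2" "z *\<^sub>R unit_flow w2 \<le> subvec (arcs G2) cu"
    using z by (auto simp: transfer_set_def)
  have scale: "l \<le> t * x \<and> t * x \<le> u" if "l \<le> x" "x \<le> u" "l \<le> 0" "0 \<le> u" for l x u :: real
  proof -
    have "t * x \<in> closed_segment 0 x"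
      using t by (auto simp: in_segment)
    moreover have "closed_segment 0 x \<subseteq> {l..u}"
      using that by (simp add: closed_segment_subset)
    ultimately show ?thesis by auto
  qed
  have "subvec (arcs G2) cl $ e \<le> t * (z * unit_flow w2 $ e) \<and>
      t * (z * unit_flow w2 $ e) \<le> subvec (arcs G2) cu $ e" for e
    using w2(3,4) cl_neg[of e] cu_pos[of e] arcs_part2
    by (intro scale) (auto simp: less_eq_vec_def subvec_nth split: if_splits)
  then show ?thesis
    using w2(1,2) by (auto simp: transfer_set_def less_eq_vec_def mult.assoc)
qed

lemma transfers_extrema:
  assumes "weq \<in> equiv_weight_range G2 v1 v2 wl wu"
  shows "\<exists>m. is_min_of (transfers weq) m" "\<exists>m. is_max_of (transfers weq) m"
  using zero_transfer[OF assms] compact_transfers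
  by (auto intro!: is_min_of_compact is_max_of_compact)

text \<open>This is what makes the two bounds on the virtual link an exact description of the
  second part: the set of its transfers is compact and star-shaped about zero, hence an
  interval.\<close>

lemma transfers_interval:
  assumes weq: "weq \<in> equiv_weight_range G2 v1 v2 wl wu"
  shows "z \<in> transfers weq \<longleftrightarrow>
    g_lower G2 v1 v2 wl wu cl cu weq \<le> z \<and> z \<le> g_upper G2 v1 v2 wl wu cl cu weq"
proof -
  obtain l u where l: "is_min_of (transfers weq) l" and u: "is_max_of (transfers weq) u"
    using transfers_extrema[OF weq] by blast
  have lu: "l \<in> transfers weq" "u \<in> transfers weq" "l \<le> 0" "0 \<le> u"
    using l u zero_transfer[OF weq] by (auto simp: is_min_of_def is_max_of_def)
  have "z \<in> transfers weq" if "l \<le> z" "z \<le> u"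
  proof -
    have "\<exists>b\<in>transfers weq. \<exists>t. 0 \<le> t \<and> t \<le> 1 \<and> z = t * b"
    proof (cases "z = 0")
      case True
      then show ?thesis using lu(1) by (intro bexI[of _ l] exI[of _ 0]) auto
    next
      case False
      show ?thesis
      proof (cases "z < 0")
        case True
        then show ?thesis
          using that lu(1) by (intro bexI[of _ l] exI[of _ "z / l"]) (auto simp: field_simps)
      next
        case nonneg: False
        then show ?thesis
          using that False lu(2)
          by (intro bexI[of _ u] exI[of _ "z / u"]) (auto simp: field_simps)
      qed
    qed
    then show ?thesis using transfer_scale by blast
  qed
  moreover have "l \<le> z \<and> z \<le> u" if "z \<in> transfers weq"
    using that l u by (auto simp: is_min_of_def is_max_of_def)
  ultimately show ?thesis
    unfolding g_lower_def g_upper_def Least_is_min_of[OF l] Greatest_is_max_of[OF u] by blast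
qed


section \<open>Equality of the feasible sets\<close>

text \<open>A nongenerative disturbance acts only where there was supply or demand before, and all
  such vertices lie in the first part.\<close>

lemma disturbed_supply:
  assumes "balanced p0" and \<delta>: "\<delta> \<in> unit_disturbances G p0"
  shows "p0 + \<mu> *\<^sub>R \<delta> \<in> coord_space (verts G1)" "balanced (p0 + \<mu> *\<^sub>R \<delta>)"
proof -
  have "\<delta> $ v = 0" if "v \<notin> verts G1" for v
    using \<delta> p0_supported that
    by (cases "v \<in> verts G") (auto simp: unit_disturbances_def nongenerative_def coord_space_def)
  then show "p0 + \<mu> *\<^sub>R \<delta> \<in> coord_space (verts G1)"
    using p0_supported by (simp add: coord_space_def)
  show "balanced (p0 + \<mu> *\<^sub>R \<delta>)"
    using assms
    by (simp add: balanced_def unit_disturbances_def nongenerative_def sum.distrib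
        flip: sum_distrib_left)
qed

text \<open>The two parts interact only through the amount sent over the virtual link, so the
  capacity constraints separate: those on the first part concern the reduction alone, those on
  the second part concern its unit transfer flow, scaled by that amount.\<close>

lemma capacity_constraints_reduction:
  assumes w: "w \<in> {wl..wu}" and p: "p \<in> coord_space (verts G1)" "balanced p"
  defines "f \<equiv> dc_flow reduction (add_virtual_weight (subvec (arcs G1) w)
      (H (subvec (arcs G2) w))) p"
    and "fa \<equiv> unit_flow (subvec (arcs G2) w)"
  shows "cl \<le> dc_flow G w p \<and> dc_flow G w p \<le> cu \<longleftrightarrow>
    (\<forall>e\<in>arcs G1. cl $ e \<le> f $ Some e \<and> f $ Some e \<le> cu $ e) \<and>
    subvec (arcs G2) cl \<le> f $ None *\<^sub>R fa \<and> f $ None *\<^sub>R fa \<le> subvec (arcs G2) cu"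
proof -
  have flow: "dc_flow G w p $ e = (if e \<in> arcs G1 then f $ Some e else f $ None * fa $ e)" for e
    using dc_flow_reduction[OF box_pos[OF w] p] by (simp add: f_def fa_def)
  have off: "fa $ e = 0" if "e \<notin> arcs G2" for e
    using that by (simp add: fa_def part2.dc_flow_potential potential_flow_def)
  have "(cl $ e \<le> dc_flow G w p $ e \<and> dc_flow G w p $ e \<le> cu $ e) \<longleftrightarrow>
      (e \<in> arcs G1 \<longrightarrow> cl $ e \<le> f $ Some e \<and> f $ Some e \<le> cu $ e) \<and>
      subvec (arcs G2) cl $ e \<le> f $ None * fa $ e \<and>
      f $ None * fa $ e \<le> subvec (arcs G2) cu $ e" for e
  proof -
    consider "e \<in> arcs G1" "e \<notin> arcs G2" | "e \<in> arcs G2" "e \<notin> arcs G1"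
      | "e \<notin> arcs G1" "e \<notin> arcs G2" "e \<notin> arcs G"
      using partition(3,4) by blast
    then show ?thesis
      using coord(3,4) by cases (simp_all add: flow off subvec_nth coord_space_def)
  qed
  then show ?thesis by (auto simp: less_eq_vec_def)
qed

text \<open>
  The weights of the second part influence the reduction only through their equivalent weight
  \<open>weq\<close>. Once \<open>weq\<close> is fixed, they remain free to realise the demanded transfer within the
  capacities, and that they can do so means that the transfer belongs to \<open>transfers weq\<close>. Since
  the parts share no arc, weights chosen separately for each combine to weights of the whole
  network.
\<close>

lemma feasible_magnitudes_reduction:
  assumes "balanced p0" and \<delta>: "\<delta> \<in> unit_disturbances G p0"
  shows "feasible_magnitudes G wl wu cl cu p0 \<delta> =
    reduced_feasible_magnitudes G1 G2 v1 v2 wl wu cl cu p0 \<delta>"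
proof (intro set_eqI iffI)
  fix \<mu> assume "\<mu> \<in> feasible_magnitudes G wl wu cl cu p0 \<delta>"
  then obtain w where w: "w \<in> {wl..wu}" and \<mu>: "0 \<le> \<mu>"
    and flow: "cl \<le> dc_flow G w (p0 + \<mu> *\<^sub>R \<delta>)" "dc_flow G w (p0 + \<mu> *\<^sub>R \<delta>) \<le> cu"
    by (auto simp: feasible_magnitudes_def)
  define w1 w2 where "w1 = subvec (arcs G1) w" and "w2 = subvec (arcs G2) w"
  let ?p = "p0 + \<mu> *\<^sub>R \<delta>"
  let ?f = "dc_flow reduction (add_virtual_weight w1 (H w2)) ?p"
  note p = disturbed_supply[OF assms, of \<mu>]
  have w2: "w2 \<in> box2" and w1: "w1 \<in> {subvec (arcs G1) wl..subvec (arcs G1) wu}"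
    using w by (auto simp: w1_def w2_def intro: subvec_mono)
  have range: "H w2 \<in> equiv_weight_range G2 v1 v2 wl wu"
    unfolding equiv_weight_box[symmetric] using w2 by (rule imageI)
  have cap: "\<forall>e\<in>arcs G1. cl $ e \<le> ?f $ Some e \<and> ?f $ Some e \<le> cu $ e"
      "subvec (arcs G2) cl \<le> ?f $ None *\<^sub>R unit_flow w2"
      "?f $ None *\<^sub>R unit_flow w2 \<le> subvec (arcs G2) cu"
    using capacity_constraints_reduction[OF w p] flow by (auto simp: w1_def w2_def)
  then have "?f $ None \<in> transfers (H w2)"
    using w2 by (auto simp: transfer_set_def)
  then show "\<mu> \<in> reduced_feasible_magnitudes G1 G2 v1 v2 wl wu cl cu p0 \<delta>"
    unfolding reduced_feasible_magnitudes_def mem_Collect_eq Let_def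
      subvec_coord_space[OF p(1)]
    using \<mu> w1 range cap(1) transfers_interval[OF range] by blast
next
  fix \<mu> assume mem: "\<mu> \<in> reduced_feasible_magnitudes G1 G2 v1 v2 wl wu cl cu p0 \<delta>"
  note p = disturbed_supply[OF assms, of \<mu>]
  let ?p = "p0 + \<mu> *\<^sub>R \<delta>"
  let ?f = "\<lambda>w1 weq. dc_flow reduction (add_virtual_weight w1 weq) ?p"
  obtain w1 weq where \<mu>: "0 \<le> \<mu>"
    and w1: "w1 \<in> {subvec (arcs G1) wl..subvec (arcs G1) wu}"
    and range: "weq \<in> equiv_weight_range G2 v1 v2 wl wu"
    and cap1: "\<forall>e\<in>arcs G1. cl $ e \<le> ?f w1 weq $ Some e \<and> ?f w1 weq $ Some e \<le> cu $ e"
    and virt: "g_lower G2 v1 v2 wl wu cl cu weq \<le> ?f w1 weq $ None"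
      "?f w1 weq $ None \<le> g_upper G2 v1 v2 wl wu cl cu weq"
    using mem unfolding reduced_feasible_magnitudes_def mem_Collect_eq Let_def
      subvec_coord_space[OF p(1)]
    by blast
  have "?f w1 weq $ None \<in> transfers weq"
    using transfers_interval[OF range] virt by blast
  then obtain w2 where w2: "w2 \<in> box2" and weq: "H w2 = weq"
    and cap2: "subvec (arcs G2) cl \<le> ?f w1 weq $ None *\<^sub>R unit_flow w2"
      "?f w1 weq $ None *\<^sub>R unit_flow w2 \<le> subvec (arcs G2) cu"
    by (auto simp: transfer_set_def)
  define w where "w = w1 + w2"
  have off1: "w1 $ e = 0" if "e \<notin> arcs G1" for e
    using w1 that by (auto simp: less_eq_vec_def subvec_nth dest!: spec[of _ e])
  have off2: "w2 $ e = 0" if "e \<notin> arcs G2" for e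
    using w2 that by (auto simp: less_eq_vec_def subvec_nth dest!: spec[of _ e])
  have sub: "subvec (arcs G1) w = w1" "subvec (arcs G2) w = w2"
    using off1 off2 partition(4) by (auto simp: w_def vec_eq_iff subvec_nth)
  have w: "w \<in> {wl..wu}"
  proof -
    have join: "x = subvec (arcs G1) x + subvec (arcs G2) x" if "x \<in> coord_space (arcs G)"
      for x :: "real ^ 'e"
      using that partition(3,4) by (auto simp: vec_eq_iff subvec_nth coord_space_def)
    show ?thesis
      using w1 w2 by (subst join[OF coord(1)], subst join[OF coord(2)])
        (auto simp: w_def intro: add_mono)
  qed
  have "cl \<le> dc_flow G w ?p \<and> dc_flow G w ?p \<le> cu"
    unfolding capacity_constraints_reduction[OF w p] sub weq using cap1 cap2 by blast
  then show "\<mu> \<in> feasible_magnitudes G wl wu cl cu p0 \<delta>"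
    using w \<mu> by (auto simp: feasible_magnitudes_def)
qed

lemma compact_feasible_magnitudes:
  assumes "balanced p0" and \<delta>: "\<delta> \<in> unit_disturbances G p0"
  shows "compact (feasible_magnitudes G wl wu cl cu p0 \<delta>)"
proof -
  let ?F = "\<lambda>w t. dc_flow G w p0 + t *\<^sub>R dc_flow G w \<delta>"
  have "\<exists>v. \<delta> $ v \<noteq> 0"
  proof (rule ccontr)
    assume "\<not> ?thesis"
    then show False using \<delta> by (simp add: unit_disturbances_def)
  qed
  then obtain v where v: "\<delta> $ v \<noteq> 0" by blast
  have cont: "continuous_on {wl..wu} (\<lambda>w. dc_flow G w p)" for p
    by (rule continuous_on_subset[OF whole.continuous_on_dc_flow]) (use box_pos in blast)
  have "compact {t. \<exists>w\<in>{wl..wu}. cl \<le> ?F w t \<and> ?F w t \<le> cu}"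
  proof (rule compact_affine_feasible[OF _ cont cont])
    show "compact {wl..wu}" by (metis cbox_interval compact_cbox)
    fix w t
    assume w: "w \<in> {wl..wu}" and F: "cl \<le> ?F w t" "?F w t \<le> cu"
    let ?K = "\<Sum>e\<in>UNIV. \<bar>cl $ e\<bar> + \<bar>cu $ e\<bar>"
    \<comment> \<open>bounded flows have bounded divergence, and the divergence grows with \<open>t\<close> at \<open>v\<close>\<close>
    have "incidence G *v ?F w t = p0 + t *\<^sub>R \<delta>"
      using disturbed_supply[OF assms, of t] verts_part1 box_pos[OF w]
      by (subst whole.dc_flow_linear[symmetric], intro whole.dc_flow_conservation)
        (auto simp: coord_space_def)
    then have "\<bar>p0 $ v + t * \<delta> $ v\<bar> \<le> ?K"
      using whole.divergence_bound[OF F, of v] by simp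
    then have "\<bar>t\<bar> * \<bar>\<delta> $ v\<bar> \<le> ?K + \<bar>p0 $ v\<bar>"
      unfolding abs_mult[symmetric] by linarith
    then show "\<bar>t\<bar> \<le> (?K + \<bar>p0 $ v\<bar>) / \<bar>\<delta> $ v\<bar>"
      using v by (simp add: pos_le_divide_eq)
  qed
  then have "compact ({t. \<exists>w\<in>{wl..wu}. cl \<le> ?F w t \<and> ?F w t \<le> cu} \<inter> {0..})"
    by (intro compact_Int_closed closed_atLeast)
  also have "{t. \<exists>w\<in>{wl..wu}. cl \<le> ?F w t \<and> ?F w t \<le> cu} \<inter> {0..}
      = feasible_magnitudes G wl wu cl cu p0 \<delta>"
    by (auto simp: feasible_magnitudes_def whole.dc_flow_linear)
  finally show ?thesis .
qed

end

theorem proposition7: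
  fixes G G1 G2 :: "('v::finite, 'e::finite) pre_digraph"
    and v1 v2 :: 'v
    and wl wu w0 cl cu :: "real ^ 'e"
    and p0 :: "real ^ 'v"
  assumes "multigraph G" and "weakly_connected G"
    and "wl \<in> coord_space (arcs G)" and "wu \<in> coord_space (arcs G)"
    and "cl \<in> coord_space (arcs G)" and "cu \<in> coord_space (arcs G)"
    and "p0 \<in> coord_space (verts G)"
    and "\<forall>i\<in>arcs G. 0 < wl $ i" and "\<forall>i\<in>arcs G. 0 < wu $ i" and "wl \<le> wu"
    and "\<forall>i\<in>arcs G. cl $ i < 0" and "\<forall>i\<in>arcs G. 0 < cu $ i"
    and "balanced p0"
    and "w0 \<in> {wl..wu}" and "cl \<le> dc_flow G w0 p0" and "dc_flow G w0 p0 \<le> cu"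
    and "reducible_via G v1 v2 p0 G1 G2"
  shows
    "(\<forall>weq\<in>equiv_weight_range G2 v1 v2 wl wu.
        (\<exists>m. is_min_of (transfer_set G2 v1 v2 wl wu cl cu weq) m) \<and>
        (\<exists>m. is_max_of (transfer_set G2 v1 v2 wl wu cl cu weq) m)) \<and>
     (\<forall>\<delta>\<in>unit_disturbances G p0.
        (\<exists>m. is_max_of (feasible_magnitudes G wl wu cl cu p0 \<delta>) m) \<and>
        (\<exists>m. is_max_of (reduced_feasible_magnitudes G1 G2 v1 v2 wl wu cl cu p0 \<delta>) m)) \<and>
     weight_control_value G wl wu cl cu p0 =
       reduced_weight_control_value G G1 G2 v1 v2 wl wu cl cu p0 \<and>
     (\<forall>m. is_min_of (max_magnitude G wl wu cl cu p0 ` unit_disturbances G p0) m \<longleftrightarrow>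
          is_min_of (reduced_max_magnitude G1 G2 v1 v2 wl wu cl cu p0 `
            unit_disturbances G p0) m)"
proof -
  have "loopfree_digraph G"
    using \<open>multigraph G\<close> by (simp add: multigraph_def)
  then interpret bounded_partition G G1 G2 v1 v2 p0 wl wu cl cu
    using assms by (intro bounded_partition.intro two_terminal_partition.intro
      bounded_partition_axioms.intro) auto
  have eq: "feasible_magnitudes G wl wu cl cu p0 \<delta> =
      reduced_feasible_magnitudes G1 G2 v1 v2 wl wu cl cu p0 \<delta>"
    if "\<delta> \<in> unit_disturbances G p0" for \<delta>
    using feasible_magnitudes_reduction[OF \<open>balanced p0\<close> that] .
  then have max_eq: "max_magnitude G wl wu cl cu p0 \<delta> =
      reduced_max_magnitude G1 G2 v1 v2 wl wu cl cu p0 \<delta>"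
    if "\<delta> \<in> unit_disturbances G p0" for \<delta>
    using that by (simp add: max_magnitude_def reduced_max_magnitude_def)
  have "\<exists>m. is_max_of (feasible_magnitudes G wl wu cl cu p0 \<delta>) m"
    if "\<delta> \<in> unit_disturbances G p0" for \<delta>
  proof (rule is_max_of_compact)
    show "compact (feasible_magnitudes G wl wu cl cu p0 \<delta>)"
      using compact_feasible_magnitudes[OF \<open>balanced p0\<close> that] .
    have "0 \<in> feasible_magnitudes G wl wu cl cu p0 \<delta>"
      using assms(14-16) by (auto simp: feasible_magnitudes_def)
    then show "feasible_magnitudes G wl wu cl cu p0 \<delta> \<noteq> {}" by blast
  qed
  moreover have "weight_control_value G wl wu cl cu p0 =
      reduced_weight_control_value G G1 G2 v1 v2 wl wu cl cu p0"
    unfolding weight_control_value_def reduced_weight_control_value_def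
    by (intro INF_cong refl) (simp add: max_eq)
  moreover have "max_magnitude G wl wu cl cu p0 ` unit_disturbances G p0 =
      reduced_max_magnitude G1 G2 v1 v2 wl wu cl cu p0 ` unit_disturbances G p0"
    by (intro image_cong refl max_eq)
  ultimately show ?thesis
    using transfers_extrema eq by simp
qed

end
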